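(* Let $\Gamma=\{\mathcal N,\{\mathcal A_i\}_{i\in\mathcal N},\{J_i\}_{i\in\mathcal N}\}$ be the two-player load-balancing game with players $\mathcal N=\{\mathrm{DL},\mathrm{UL}\}$, strategy spaces $\mathcal A_{\mathrm{DL}}=[0,1]^N$ and $\mathcal A_{\mathrm{UL}}=[0,1]^M$, and payoffs $$J_{\mathrm{DL}}(\boldsymbol\alpha^{\mathrm{DL}},\boldsymbol\alpha^{\mathrm{UL}})=\sum_{u\in\mathcal U_{\mathrm{DL}}}\pi_u U_u(\alpha_u^{\mathrm{DL}})-\mu\,C(\boldsymbol\alpha^{\mathrm{DL}},\boldsymbol\alpha^{\mathrm{UL}}),$$ $$J_{\mathrm{UL}}(\boldsymbol\alpha^{\mathrm{DL}},\boldsymbol\alpha^{\mathrm{UL}})=\sum_{v\in\mathcal U_{\mathrm{UL}}}\pi_v U_v(\alpha_v^{\mathrm{UL}})-\mu\,C(\boldsymbol\alpha^{\mathrm{DL}},\boldsymbol\alpha^{\mathrm{UL}}),$$ where the utilities $U_u$ and the coupling penalty $C$ are as defined in the context. Then $\Gamma$ has a pure-strategy Nash equilibrium.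
   Context: Slices and strategies. $\mathcal U_{\mathrm{DL}}=\{1,\dots,N\}$ and $\mathcal U_{\mathrm{UL}}=\{1,\dots,M\}$ are the finite sets of slices controlled by the downlink and uplink players. Player DL chooses $\boldsymbol\alpha^{\mathrm{DL}}=(\alpha^{\mathrm{DL}}_1,\dots,\alpha^{\mathrm{DL}}_N)\in[0,1]^N$, player UL chooses $\boldsymbol\alpha^{\mathrm{UL}}=(\alpha^{\mathrm{UL}}_1,\dots,\alpha^{\mathrm{UL}}_M)\in[0,1]^M$. The joint strategy space is $\mathcal A=[0,1]^N\times[0,1]^M$. Parameters (fixed real constants). Each slice $u$ has a priority weight $\pi_u\ge 0$ and a traffic class $c_u$. Each class $c$ has weights $w_T^{c},w_L^{c},w_R^{c},w_P^{c}\ge0$, a severity multiplier $\lambda^{c}\ge0$, a latency ceiling $d^{\max}_c>0$, and thresholds $s_k^{c}>0$ for $k\in\{\mathrm{rtt},\mathrm{loss},\mathrm{jitter}\}$. The two links (NTN and fiber) have capacity estimates $\hat C^{\mathrm{ntn}},\hat C^{\mathrm{fib}}>0$, latencies $d^{\mathrm{ntn}},d^{\mathrm{fib}}$, loss rates $\ell^{\mathrm{ntn}},\ell^{\mathrm{fib}}$, and metric values $\mathtt{metric}_{k,\mathrm{ntn}},\mathtt{metric}_{k,\mathrm{fib}}$ for each $k$. The demands are $\hat b_u^{\mathrm{DL}}>0$ ($u\in\mathcal U_{\mathrm{DL}}$) and $\hat b_v^{\mathrm{UL}}>0$ ($v\in\mathcal U_{\mathrm{UL}}$); $\mu>0$ is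 a coupling coefficient. Utilities. For $\alpha_u\in[0,1]$, $$U_u(\alpha_u)=w_T^{c_u}T_u(\alpha_u)+w_L^{c_u}L_u(\alpha_u)+w_R^{c_u}R_u(\alpha_u)-w_P^{c_u}\lambda^{c_u}P_u(\alpha_u),$$ with $T_u(\alpha_u)=\ln\bigl(1+\alpha_u\hat C^{\mathrm{ntn}}+(1-\alpha_u)\hat C^{\mathrm{fib}}\bigr)$, $L_u(\alpha_u)=-\dfrac{\alpha_u d^{\mathrm{ntn}}+(1-\alpha_u)d^{\mathrm{fib}}}{d^{\max}_{c_u}}$, $R_u(\alpha_u)=\alpha_u(1-\ell^{\mathrm{ntn}})+(1-\alpha_u)(1-\ell^{\mathrm{fib}})$, $P_u(\alpha_u)=\sum_{k}\Bigl(\dfrac{\max(0,m_k(\alpha_u)-s_k^{c_u})}{s_k^{c_u}}\Bigr)^2$, where $m_k(\alpha_u)=\alpha_u\,\mathtt{metric}_{k,\mathrm{ntn}}+(1-\alpha_u)\,\mathtt{metric}_{k,\mathrm{fib}}$ and $k$ ranges over $\{\mathrm{rtt},\mathrm{loss},\mathrm{jitter}\}$. Coupling penalty. With $D_{\mathrm{ntn}}=\sum_{u\in\mathcal U_{\mathrm{DL}}}\alpha_u^{\mathrm{DL}}\hat b_u^{\mathrm{DL}}+\sum_{v\in\mathcal U_{\mathrm{UL}}}\alpha_v^{\mathrm{UL}}\hat b_v^{\mathrm{UL}}$ and $D_{\mathrm{fib}}=\sum_{u\in\mathcal U_{\mathrm{DL}}}(1-\alpha_u^{\mathrm{DL}})\hat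 b_u^{\mathrm{DL}}+\sum_{v\in\mathcal U_{\mathrm{UL}}}(1-\alpha_v^{\mathrm{UL}})\hat b_v^{\mathrm{UL}}$, $$C(\boldsymbol\alpha^{\mathrm{DL}},\boldsymbol\alpha^{\mathrm{UL}})=\bigl[\max(0,D_{\mathrm{ntn}}-\hat C^{\mathrm{ntn}})\bigr]^2+\bigl[\max(0,D_{\mathrm{fib}}-\hat C^{\mathrm{fib}})\bigr]^2.$$ Nash equilibrium. A (pure-strategy) Nash equilibrium is a profile $(\boldsymbol\alpha^{\mathrm{DL}*},\boldsymbol\alpha^{\mathrm{UL}*})\in\mathcal A$ such that $J_{\mathrm{DL}}(\boldsymbol\alpha^{\mathrm{DL}*},\boldsymbol\alpha^{\mathrm{UL}*})\ge J_{\mathrm{DL}}(\boldsymbol\alpha^{\mathrm{DL}},\boldsymbol\alpha^{\mathrm{UL}*})$ for all $\boldsymbol\alpha^{\mathrm{DL}}\in[0,1]^N$ and $J_{\mathrm{UL}}(\boldsymbol\alpha^{\mathrm{DL}*},\boldsymbol\alpha^{\mathrm{UL}*})\ge J_{\mathrm{UL}}(\boldsymbol\alpha^{\mathrm{DL}*},\boldsymbol\alpha^{\mathrm{UL}})$ for all $\boldsymbol\alpha^{\mathrm{UL}}\in[0,1]^M$. *)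

theory Defs
  imports "HOL-Analysis.Analysis"
begin

record ('a, 'b) two_player_game =
  strategies1 :: "'a set"
  strategies2 :: "'b set"
  payoff1 :: "'a \<Rightarrow> 'b \<Rightarrow> real"
  payoff2 :: "'a \<Rightarrow> 'b \<Rightarrow> real"

definition nash_equilibrium :: "('a, 'b) two_player_game \<Rightarrow> 'a \<times> 'b \<Rightarrow> bool" where
  "nash_equilibrium G = (\<lambda>(a, b).
     a \<in> strategies1 G \<and> b \<in> strategies2 G \<and>
     (\<forall>a' \<in> strategies1 G. payoff1 G a b \<ge> payoff1 G a' b) \<and>
     (\<forall>b' \<in> strategies2 G. payoff2 G a b \<ge> payoff2 G a b'))"

datatype kpi = RTT | LOSS | JITTER

record link =
  capacity :: real
  latency :: real
  loss_rate :: real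
  kpi_value :: "kpi \<Rightarrow> real"

record traffic_class =
  w_T :: real
  w_L :: real
  w_R :: real
  w_P :: real
  severity :: real
  d_max :: real
  threshold :: "kpi \<Rightarrow> real"

record 'c slice =
  priority :: real
  slice_class :: 'c
  demand :: real

record 'c network =
  ntn :: link
  fib :: link
  class_params :: "'c \<Rightarrow> traffic_class"

definition valid_link :: "link \<Rightarrow> bool" where
  "valid_link l \<longleftrightarrow> capacity l > 0"

definition valid_class :: "traffic_class \<Rightarrow> bool" where
  "valid_class c \<longleftrightarrow>
     w_T c \<ge> 0 \<and> w_L c \<ge> 0 \<and> w_R c \<ge> 0 \<and> w_P c \<ge> 0 \<and> severity c \<ge> 0 \<and>
     d_max c > 0 \<and> (\<forall>k. threshold c k > 0)"

definition valid_network :: "'c network \<Rightarrow> bool" where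
  "valid_network E \<longleftrightarrow> valid_link (ntn E) \<and> valid_link (fib E) \<and> (\<forall>c. valid_class (class_params E c))"

definition valid_slice :: "'c slice \<Rightarrow> bool" where
  "valid_slice u \<longleftrightarrow> priority u \<ge> 0 \<and> demand u > 0"

definition throughput_term :: "'c network \<Rightarrow> real \<Rightarrow> real" where
  "throughput_term E x = ln (1 + x * capacity (ntn E) + (1 - x) * capacity (fib E))"

definition latency_term :: "'c network \<Rightarrow> 'c \<Rightarrow> real \<Rightarrow> real" where
  "latency_term E c x =
     - ((x * latency (ntn E) + (1 - x) * latency (fib E)) / d_max (class_params E c))"

definition reliability_term :: "'c network \<Rightarrow> real \<Rightarrow> real" where
  "reliability_term E x = x * (1 - loss_rate (ntn E)) + (1 - x) * (1 - loss_rate (fib E))"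

definition mixed_kpi :: "'c network \<Rightarrow> kpi \<Rightarrow> real \<Rightarrow> real" where
  "mixed_kpi E k x = x * kpi_value (ntn E) k + (1 - x) * kpi_value (fib E) k"

definition penalty_term :: "'c network \<Rightarrow> 'c \<Rightarrow> real \<Rightarrow> real" where
  "penalty_term E c x =
     (\<Sum>k\<in>{RTT, LOSS, JITTER}.
        (max 0 (mixed_kpi E k x - threshold (class_params E c) k)
           / threshold (class_params E c) k)\<^sup>2)"

definition utility :: "'c network \<Rightarrow> 'c slice \<Rightarrow> real \<Rightarrow> real" where
  "utility E u x =
     (let c = slice_class u; p = class_params E c in
        w_T p * throughput_term E x + w_L p * latency_term E c x
        + w_R p * reliability_term E x - w_P p * severity p * penalty_term E c x)"

definition ntn_demand ::
  "nat \<Rightarrow> nat \<Rightarrow> (nat \<Rightarrow> 'c slice) \<Rightarrow> (nat \<Rightarrow> 'c slice) \<Rightarrow> (nat \<Rightarrow> real) \<Rightarrow> (nat \<Rightarrow> real) \<Rightarrow> real" where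
  "ntn_demand N M dl ul a b =
     (\<Sum>u\<in>{1..N}. a u * demand (dl u)) + (\<Sum>v\<in>{1..M}. b v * demand (ul v))"

definition fib_demand ::
  "nat \<Rightarrow> nat \<Rightarrow> (nat \<Rightarrow> 'c slice) \<Rightarrow> (nat \<Rightarrow> 'c slice) \<Rightarrow> (nat \<Rightarrow> real) \<Rightarrow> (nat \<Rightarrow> real) \<Rightarrow> real" where
  "fib_demand N M dl ul a b =
     (\<Sum>u\<in>{1..N}. (1 - a u) * demand (dl u)) + (\<Sum>v\<in>{1..M}. (1 - b v) * demand (ul v))"

definition coupling_penalty ::
  "'c network \<Rightarrow> nat \<Rightarrow> nat \<Rightarrow> (nat \<Rightarrow> 'c slice) \<Rightarrow> (nat \<Rightarrow> 'c slice) \<Rightarrow>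
   (nat \<Rightarrow> real) \<Rightarrow> (nat \<Rightarrow> real) \<Rightarrow> real" where
  "coupling_penalty E N M dl ul a b =
     (max 0 (ntn_demand N M dl ul a b - capacity (ntn E)))\<^sup>2
     + (max 0 (fib_demand N M dl ul a b - capacity (fib E)))\<^sup>2"

text \<open>A point of the cube \<open>[0,1]\<^sup>N\<close> is an extensional function on the slice indices \<open>{1..N}\<close>.
  Downlink and uplink slices are indexed separately, so each family has its own priorities,
  classes and demands.\<close>

definition load_balancing_game ::
  "'c network \<Rightarrow> nat \<Rightarrow> nat \<Rightarrow> (nat \<Rightarrow> 'c slice) \<Rightarrow> (nat \<Rightarrow> 'c slice) \<Rightarrow> real \<Rightarrow>
   (nat \<Rightarrow> real, nat \<Rightarrow> real) two_player_game" where
  "load_balancing_game E N M dl ul \<mu> = \<lparr>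
     strategies1 = {1..N} \<rightarrow>\<^sub>E {0..1},
     strategies2 = {1..M} \<rightarrow>\<^sub>E {0..1},
     payoff1 = (\<lambda>a b. (\<Sum>u\<in>{1..N}. priority (dl u) * utility E (dl u) (a u))
                       - \<mu> * coupling_penalty E N M dl ul a b),
     payoff2 = (\<lambda>a b. (\<Sum>v\<in>{1..M}. priority (ul v) * utility E (ul v) (b v))
                       - \<mu> * coupling_penalty E N M dl ul a b)\<rparr>"

end

(* The coupling penalty enters both payoffs identically, so the sum of all weighted utilities minus
   the penalty is an exact potential: it changes by the same amount as a player's payoff
   whenever that player deviates. It is continuous on the compact set of joint strategies, and any
   maximizer of it is an equilibrium. *)
theory Submission
  imports Defs
begin

text \<open>A unilateral deviation changes the deviator's payoff exactly as it changes
  \<open>\<Phi>\<close>, and no change of \<open>\<Phi>\<close> from a maximizer is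
  positive.\<close>

lemma nash_equilibrium_if_maximizes_exact_potential:
  assumes "a \<in> strategies1 G" "b \<in> strategies2 G"
    and max: "\<And>a' b'. a' \<in> strategies1 G \<Longrightarrow> b' \<in> strategies2 G \<Longrightarrow> \<Phi> a' b' \<le> \<Phi> a b"
    and pot1: "\<And>a' a b. payoff1 G a' b - payoff1 G a b = \<Phi> a' b - \<Phi> a b"
    and pot2: "\<And>a b b'. payoff2 G a b' - payoff2 G a b = \<Phi> a b' - \<Phi> a b"
  shows "nash_equilibrium G (a, b)"
proof -
  have "payoff1 G a' b \<le> payoff1 G a b" if "a' \<in> strategies1 G" for a'
    using max[OF that assms(2)] pot1[of a' b a] by linarith
  moreover have "payoff2 G a b' \<le> payoff2 G a b" if "b' \<in> strategies2 G" for b'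
    using max[OF assms(1) that] pot2[of a b' b] by linarith
  ultimately show ?thesis
    using assms(1,2) by (simp add: nash_equilibrium_def)
qed

text \<open>Tychonoff's theorem: extensionality fixes each coordinate outside \<open>I\<close> to
  \<open>undefined\<close>, so the set is a product over the whole index type whose additional
  factors are compact singletons.\<close>

lemma compact_PiE_product:
  fixes S :: "'i \<Rightarrow> 'a::topological_space set"
  assumes "\<And>i. i \<in> I \<Longrightarrow> compact (S i)"
  shows "compact (PiE I S)"
proof -
  have "PiE I S = PiE UNIV (\<lambda>i. if i \<in> I then S i else {undefined})"
    by (auto simp: PiE_def Pi_def extensional_def split: if_splits)
  moreover have "compactin (product_topology (\<lambda>_. euclidean) UNIV)
      (PiE UNIV (\<lambda>i. if i \<in> I then S i else {undefined}))"
    unfolding compactin_PiE using assms by simp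
  ultimately show ?thesis
    by (simp add: euclidean_product_topology)
qed

text \<open>On the unit interval the argument of \<open>ln\<close> is at least 1 because capacities
  are positive, and the denominators are positive constants. The hinge in the KPI penalty is
  continuous, so no case split at the thresholds arises.\<close>

lemma continuous_on_utility:
  assumes "valid_network E"
  shows "continuous_on {0..1} (utility E u)"
proof -
  have "1 + x * capacity (ntn E) + (1 - x) * capacity (fib E) \<noteq> 0" if "x \<in> {0..1}" for x
  proof -
    have "0 \<le> x * capacity (ntn E)" "0 \<le> (1 - x) * capacity (fib E)"
      using that assms by (simp_all add: valid_network_def valid_link_def)
    then show ?thesis by linarith
  qed
  moreover have "d_max (class_params E c) \<noteq> 0" "threshold (class_params E c) k \<noteq> 0" for c k
    using assms by (auto simp: valid_network_def valid_class_def less_imp_neq[symmetric])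
  ultimately show ?thesis
    unfolding utility_def throughput_term_def latency_term_def reliability_term_def
      penalty_term_def mixed_kpi_def Let_def
    by (intro continuous_intros) auto
qed

theorem mainTheorem2:
  fixes E :: "'c network" and N M :: nat
    and dl ul :: "nat \<Rightarrow> 'c slice" and \<mu> :: real
  assumes "valid_network E"
    and "\<forall>u\<in>{1..N}. valid_slice (dl u)"
    and "\<forall>v\<in>{1..M}. valid_slice (ul v)"
    and "\<mu> > 0"
  shows "\<exists>p. nash_equilibrium (load_balancing_game E N M dl ul \<mu>) p"
proof -
  define A B where "A = {1..N} \<rightarrow>\<^sub>E {0..1::real}" and "B = {1..M} \<rightarrow>\<^sub>E {0..1::real}"
  define \<Phi> where "\<Phi> = (\<lambda>a b. (\<Sum>u\<in>{1..N}. priority (dl u) * utility E (dl u) (a u))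
    + (\<Sum>v\<in>{1..M}. priority (ul v) * utility E (ul v) (b v))
    - \<mu> * coupling_penalty E N M dl ul a b)"
  \<comment> \<open>Strategies carry the product topology, in which evaluation at an index is
    continuous.\<close>
  have fst: "continuous_on (A \<times> B) (\<lambda>p. fst p u)" for u
    by (rule continuous_on_product_then_coordinatewise[OF continuous_on_fst[OF continuous_on_id]])
  have snd: "continuous_on (A \<times> B) (\<lambda>p. snd p v)" for v
    by (rule continuous_on_product_then_coordinatewise[OF continuous_on_snd[OF continuous_on_id]])
  \<comment> \<open>The index bound places the coordinate in the unit interval, where continuity of
    \<open>utility\<close> is known; at other indices its value is \<open>undefined\<close>.\<close>
  have U1: "continuous_on (A \<times> B) (\<lambda>p. utility E (dl u) (fst p u))" if "u \<in> {1..N}" for u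
    using that
    by (intro continuous_on_compose2[OF continuous_on_utility[OF assms(1)] fst])
      (auto simp: A_def PiE_iff)
  have U2: "continuous_on (A \<times> B) (\<lambda>p. utility E (ul v) (snd p v))" if "v \<in> {1..M}" for v
    using that
    by (intro continuous_on_compose2[OF continuous_on_utility[OF assms(1)] snd])
      (auto simp: B_def PiE_iff)
  have "continuous_on (A \<times> B) (\<lambda>p. \<Phi> (fst p) (snd p))"
    unfolding \<Phi>_def coupling_penalty_def ntn_demand_def fib_demand_def
    by (intro continuous_intros U1 U2 fst snd)
  moreover have "compact (A \<times> B)"
    unfolding A_def B_def by (intro compact_Times compact_PiE_product) auto
  \<comment> \<open>This covers \<open>N = 0\<close> and \<open>M = 0\<close> too: a product over no
    indices still contains the everywhere \<open>undefined\<close> function.\<close>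
  moreover have "A \<times> B \<noteq> {}"
    by (auto simp: A_def B_def PiE_eq_empty_iff)
  ultimately have "\<exists>p\<in>A \<times> B. \<forall>q\<in>A \<times> B. \<Phi> (fst q) (snd q) \<le> \<Phi> (fst p) (snd p)"
    by (intro continuous_attains_sup)
  then obtain p where p: "p \<in> A \<times> B"
    "\<And>q. q \<in> A \<times> B \<Longrightarrow> \<Phi> (fst q) (snd q) \<le> \<Phi> (fst p) (snd p)"
    by blast
  have "nash_equilibrium (load_balancing_game E N M dl ul \<mu>) (fst p, snd p)"
  proof (rule nash_equilibrium_if_maximizes_exact_potential[where \<Phi> = \<Phi>])
    show "\<Phi> a' b' \<le> \<Phi> (fst p) (snd p)"
      if "a' \<in> strategies1 (load_balancing_game E N M dl ul \<mu>)"
        "b' \<in> strategies2 (load_balancing_game E N M dl ul \<mu>)" for a' b'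
      using p(2)[of "(a', b')"] that by (simp add: load_balancing_game_def A_def B_def)
  \<comment> \<open>In both potential identities the opponent's utility sum cancels from the
    difference of \<open>\<Phi>\<close>.\<close>
  qed (use p(1) in \<open>auto simp: load_balancing_game_def A_def B_def \<Phi>_def\<close>)
  then show ?thesis ..
qed

end
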